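(* Let $p\in[1,\infty)$. If $X$ is a compact metric space and $\varphi:X\to X$ is a continuous map with positive topological entropy, then $\varphi_\#:\mathscr{W}_p(X)\to\mathscr{W}_p(X)$ has positive metric mean dimension. More precisely \[\mathrm{mdim}_M(\varphi_\#,\mathrm{W}_p)\geqslant p\,\frac{\mathrm{h}_{\mathrm{top}}(\varphi)}{\log 2}.\]
   Context: Given a continuous self-map $\varphi$ of a compact metric space $(X,d)$ and $n\in\mathbb N$, set $d_{[n]}(x,y)=\max\{d(\varphi^i(x),\varphi^i(y)):0\le i\le n\}$. A subset $S\subset X$ is $(n,\varepsilon)$-separated if $d_{[n]}(x,y)\ge\varepsilon$ whenever $x\ne y\in S$. Let $P(\varphi,\varepsilon,n)$ be the maximal size of an $(n,\varepsilon)$-separated set. The topological entropy is $\mathrm{h}_{\mathrm{top}}(\varphi)=\lim_{\varepsilon\to0}\limsup_{n\to+\infty}\frac{\log P(\varphi,\varepsilon,n)}{n}$ and the metric mean dimension is $\mathrm{mdim}_M(\varphi,d)=\liminf_{\varepsilon\to0}\limsup_{n\to+\infty}\frac{\log P(\varphi,\varepsilon,n)}{n|\log\varepsilon|}$. For $X$ compact, $\mathscr{W}_p(X)$ is the set of all Borel probability measures on $X$ endowed with the metric $\mathrm{W}_p(\mu,\nu)=\big(\inf_\Pi\int_{X\times X}d(x,y)^p\,\Pi(dx\,dy)\big)^{1/p}$, the infimum being over all probability measures $\Pi$ on $X\times X$ with marginals $\mu$ and $\nu$; it is a compact metric space. $\varphi_\#$ is the push-forward map $\mu\mapsto\varphi_\#\mu$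 on measures; $\mathrm{mdim}_M(\varphi_\#,\mathrm{W}_p)$ is the metric mean dimension of $\varphi_\#$ acting on $(\mathscr{W}_p(X),\mathrm{W}_p)$. *)

theory Defs
  imports "HOL-Probability.Probability"
begin

text \<open>
  The dynamical notions take the space as a carrier set \<open>X\<close> with an explicit distance \<open>d\<close>, so that
  they apply both to a metric space type and to a Wasserstein space of measures.
\<close>

definition bowen_dist :: "('a \<Rightarrow> 'a \<Rightarrow> real) \<Rightarrow> ('a \<Rightarrow> 'a) \<Rightarrow> nat \<Rightarrow> 'a \<Rightarrow> 'a \<Rightarrow> real" where
  "bowen_dist d f n x y = Max ((\<lambda>i. d ((f ^^ i) x) ((f ^^ i) y)) ` {0..n})"

definition separated ::
    "'a set \<Rightarrow> ('a \<Rightarrow> 'a \<Rightarrow> real) \<Rightarrow> ('a \<Rightarrow> 'a) \<Rightarrow> nat \<Rightarrow> real \<Rightarrow> 'a set \<Rightarrow> bool" where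
  "separated X d f n \<epsilon> S \<longleftrightarrow>
     S \<subseteq> X \<and> (\<forall>x\<in>S. \<forall>y\<in>S. x \<noteq> y \<longrightarrow> bowen_dist d f n x y \<ge> \<epsilon>)"

text \<open>
  Subsets of separated sets are separated, so the supremum over finite separated sets is the maximal
  size if there is one (as for a continuous map of a compact space and \<open>\<epsilon> > 0\<close>), and \<open>\<infinity>\<close> otherwise.
\<close>

definition sep_count ::
    "'a set \<Rightarrow> ('a \<Rightarrow> 'a \<Rightarrow> real) \<Rightarrow> ('a \<Rightarrow> 'a) \<Rightarrow> real \<Rightarrow> nat \<Rightarrow> enat" where
  "sep_count X d f \<epsilon> n = (SUP S\<in>{S. finite S \<and> separated X d f n \<epsilon> S}. enat (card S))"

text \<open>Natural logarithm with \<open>ln \<infinity> = \<infinity>\<close>; the argument is at least 1 for nonempty spaces.\<close>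

definition ln_enat :: "enat \<Rightarrow> ereal" where
  "ln_enat k = (case k of enat m \<Rightarrow> ereal (ln (real m)) | \<infinity> \<Rightarrow> \<infinity>)"

definition topological_entropy ::
    "'a set \<Rightarrow> ('a \<Rightarrow> 'a \<Rightarrow> real) \<Rightarrow> ('a \<Rightarrow> 'a) \<Rightarrow> ereal" where
  "topological_entropy X d f =
     Lim (at_right 0) (\<lambda>\<epsilon>. limsup (\<lambda>n. ln_enat (sep_count X d f \<epsilon> n) / ereal (real n)))"

definition metric_mean_dimension ::
    "'a set \<Rightarrow> ('a \<Rightarrow> 'a \<Rightarrow> real) \<Rightarrow> ('a \<Rightarrow> 'a) \<Rightarrow> ereal" where
  "metric_mean_dimension X d f =
     Liminf (at_right 0)
       (\<lambda>\<epsilon>. limsup (\<lambda>n. ln_enat (sep_count X d f \<epsilon> n) / ereal (real n * \<bar>ln \<epsilon>\<bar>)))"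

definition borel_prob_measures :: "'a::topological_space measure set" where
  "borel_prob_measures = {\<mu>. sets \<mu> = sets borel \<and> prob_space \<mu>}"

text \<open>
  Couplings live on the Borel sigma-algebra of the product topology, which makes \<open>dist\<close> measurable
  without a second countability class on \<open>'a\<close>.
\<close>

definition couplings ::
    "'a::topological_space measure \<Rightarrow> 'a measure \<Rightarrow> ('a \<times> 'a) measure set" where
  "couplings \<mu> \<nu> =
     {\<gamma> \<in> borel_prob_measures. distr \<gamma> borel fst = \<mu> \<and> distr \<gamma> borel snd = \<nu>}"

text \<open>Meant for compact spaces, where every integral below is that of a bounded function.\<close>

definition wasserstein ::
    "real \<Rightarrow> 'a::metric_space measure \<Rightarrow> 'a measure \<Rightarrow> real" where
  "wasserstein p \<mu> \<nu> =
     (INF \<gamma>\<in>couplings \<mu> \<nu>. \<integral>z. dist (fst z) (snd z) powr p \<partial>\<gamma>) powr (1 / p)"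

definition push_forward ::
    "('a::topological_space \<Rightarrow> 'a) \<Rightarrow> 'a measure \<Rightarrow> 'a measure" where
  "push_forward f \<mu> = distr \<mu> borel f"

end

theory Submission
  imports Defs "HOL-Real_Asymp.Real_Asymp"
begin

text \<open>
  Let \<open>S\<close> be an \<open>(n, \<delta>)\<close>-separated set of \<open>\<phi>\<close> and attach to every \<open>k\<close>-tuple \<open>f\<close> of points of \<open>S\<close> the
  measure with mass \<open>2 ^ l / (2 ^ k - 1)\<close> at \<open>f l\<close>, for \<open>l < k\<close>. These \<open>card S ^ k\<close> measures are
  separated for the push-forward dynamics, at the same time \<open>n\<close> and at the scale
  \<open>\<delta> / k * 2 powr (- k / p)\<close> (\<open>sep_count_wasserstein_ge\<close>). Indeed, let \<open>j\<close> be the largest index at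
  which two tuples \<open>f\<close> and \<open>g\<close> differ, and \<open>i \<le> n\<close> a time at which the orbits of \<open>f j\<close> and \<open>g j\<close> are
  \<open>\<delta>\<close> apart. The atom at \<open>f j\<close> is heavier than all atoms of lower index together, by one unit
  \<open>1 / (2 ^ k - 1)\<close>, and the atoms of higher index are common to both measures. So among
  the concentric balls around the \<open>i\<close>-th iterate of \<open>f j\<close>, of radius at most \<open>\<delta>\<close>, the first measure
  has an excess of one unit. Of \<open>k\<close> disjoint annuli of width \<open>\<delta> / k\<close>, one contains no common atom;
  across it the excess must be carried, whatever the coupling (\<open>binary_distr_mass_gap\<close> and
  \<open>wasserstein_ge\<close>). The empty annulus is what makes the argument work for \<open>p > 1\<close>, where a coupling
  may profit from moving the excess along a chain of common atoms; the price is only the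
  factor \<open>1 / k\<close>.

  If \<open>c\<close> is below the topological entropy, then for some \<open>\<delta>\<close> and infinitely many \<open>n\<close> the set \<open>S\<close> can be
  taken with more than \<open>exp (c * n)\<close> points, hence \<open>exp (k * c * n)\<close> measures. At scale \<open>\<epsilon>\<close> any
  \<open>k\<close> with \<open>\<epsilon> \<le> \<delta> / k * 2 powr (- k / p)\<close> may be used, and since \<open>ln k\<close> is negligible against \<open>k\<close>,
  this allows \<open>k\<close> to be about \<open>p / ln 2 * \<bar>ln \<epsilon>\<bar>\<close> (\<open>eventually_exists_scale\<close>). Dividing \<open>k * c * n\<close> by
  \<open>n * \<bar>ln \<epsilon>\<bar>\<close> gives the bound.
\<close>

section \<open>Binary weights\<close>

definition binary_pmf :: "nat \<Rightarrow> nat pmf" where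
  "binary_pmf k = embed_pmf (\<lambda>l. if l < k then 2 ^ l / (2 ^ k - 1) else 0)"

lemma sum_pow2: "(\<Sum>l<j. (2::real) ^ l) = 2 ^ j - 1"
  by (induction j) auto

lemma pmf_binary_pmf:
  assumes "0 < k"
  shows "pmf (binary_pmf k) l = (if l < k then 2 ^ l / (2 ^ k - 1) else 0)"
  unfolding binary_pmf_def
proof (rule pmf_embed_pmf)
  have gt: "(1::real) < 2 ^ k" using assms by simp
  show "0 \<le> (if l < k then 2 ^ l / (2 ^ k - 1) else (0::real))" for l
    using gt by simp
  have "(\<integral>\<^sup>+ l. ennreal (if l < k then 2 ^ l / (2 ^ k - 1) else 0) \<partial>count_space UNIV)
      = (\<Sum>l<k. ennreal (2 ^ l / (2 ^ k - 1)))"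
    by (subst nn_integral_count_space'[where A = "{..<k}"]) auto
  also have "\<dots> = ennreal (\<Sum>l<k. 2 ^ l / (2 ^ k - 1))"
    using gt by (intro sum_ennreal) simp
  also have "(\<Sum>l<k. 2 ^ l / (2 ^ k - 1)) = (1::real)"
    using gt by (simp add: sum_pow2 flip: sum_divide_distrib)
  finally show "(\<integral>\<^sup>+ l. ennreal (if l < k then 2 ^ l / (2 ^ k - 1) else 0) \<partial>count_space UNIV) = 1"
    by simp
qed

lemma set_binary_pmf: "0 < k \<Longrightarrow> set_pmf (binary_pmf k) \<subseteq> {..<k}"
  by (auto simp: set_pmf_eq pmf_binary_pmf split: if_splits)

text \<open>
  Binary expansions are unique because each digit outweighs all lower ones together; the
  remaining unit is the mass that every coupling will have to move.
\<close>

lemma binary_pmf_dominates: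
  assumes "j < k"
  shows "measure (binary_pmf k) {j} = measure (binary_pmf k) {..<j} + 1 / (2 ^ k - 1)"
proof -
  have "measure (binary_pmf k) {..<j} = (\<Sum>l<j. 2 ^ l / (2 ^ k - 1))"
    using assms by (simp add: measure_measure_pmf_finite pmf_binary_pmf)
  also have "\<dots> = (2 ^ j - 1) / (2 ^ k - 1)"
    by (simp add: sum_pow2 flip: sum_divide_distrib)
  finally show ?thesis
    using assms by (simp add: measure_pmf_single pmf_binary_pmf flip: add_divide_distrib)
qed

section \<open>Lower bounds for the Wasserstein distance\<close>

text \<open>
  Under any coupling, the part of the mass of \<open>A\<close> that does not fit into \<open>B\<close> travels a distance at
  least \<open>\<eta>\<close>. Compactness makes the cost integrable, and a coupling must exist for the infimum to be
  bounded below by a bound on its members.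
\<close>

lemma wasserstein_ge:
  fixes \<mu> \<nu> :: "'a::metric_space measure"
  assumes p: "0 < p" and comp: "compact (UNIV :: 'a set)" and ne: "couplings \<mu> \<nu> \<noteq> {}"
    and A[measurable]: "A \<in> sets borel" and B[measurable]: "B \<in> sets borel"
    and gap: "\<And>x y. x \<in> A \<Longrightarrow> y \<notin> B \<Longrightarrow> \<eta> \<le> dist x y" and \<eta>: "0 \<le> \<eta>"
    and m: "0 \<le> m" "m \<le> measure \<mu> A - measure \<nu> B"
  shows "\<eta> * m powr (1 / p) \<le> wasserstein p \<mu> \<nu>"
proof -
  have "\<eta> powr p * m \<le> (\<integral>z. dist (fst z) (snd z) powr p \<partial>\<gamma>)" if \<gamma>: "\<gamma> \<in> couplings \<mu> \<nu>" for \<gamma>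
  proof -
    have sets_\<gamma>[simp, measurable_cong]: "sets \<gamma> = sets borel" and "prob_space \<gamma>"
      and \<mu>: "distr \<gamma> borel fst = \<mu>" and \<nu>: "distr \<gamma> borel snd = \<nu>"
      using \<gamma> by (auto simp: couplings_def borel_prob_measures_def)
    interpret prob_space \<gamma> by fact
    have sp[simp]: "space \<gamma> = UNIV" using sets_eq_imp_space_eq[OF sets_\<gamma>] by simp
    have fst_m[measurable]: "(fst :: 'a \<times> 'a \<Rightarrow> 'a) \<in> borel_measurable borel"
      by (intro borel_measurable_continuous_onI continuous_intros)
    have snd_m[measurable]: "(snd :: 'a \<times> 'a \<Rightarrow> 'a) \<in> borel_measurable borel"
      by (intro borel_measurable_continuous_onI continuous_intros)
    have dist_m[measurable]: "(\<lambda>z::'a \<times> 'a. dist (fst z) (snd z)) \<in> borel_measurable borel"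
      by (intro borel_measurable_continuous_onI continuous_intros)
    obtain D where D: "\<And>x y::'a. dist x y \<le> D"
      using compact_imp_bounded[OF comp] by (auto simp: bounded_two_points)
    have int: "integrable \<gamma> (\<lambda>z. dist (fst z) (snd z) powr p)"
      using p D by (intro integrable_const_bound[of _ "D powr p"]) (auto intro!: powr_mono2 AE_I2)
    define E where "E = (fst -` A) - (snd -` B :: ('a \<times> 'a) set)"
    have mA: "fst -` A \<in> sets \<gamma>" and mB: "snd -` B \<in> sets \<gamma>"
      using measurable_sets[OF fst_m A] measurable_sets[OF snd_m B] by auto
    then have E: "E \<in> sets \<gamma>" by (auto simp: E_def)
    have "measure \<mu> A = measure \<gamma> (fst -` A)" "measure \<nu> B = measure \<gamma> (snd -` B)"
      by (simp_all add: measure_distr flip: \<mu> \<nu>)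
    moreover have "measure \<gamma> (fst -` A) \<le> measure \<gamma> E + measure \<gamma> (snd -` B)"
      using E mA mB by (intro order.trans[OF finite_measure_mono measure_Un_le]) (auto simp: E_def)
    ultimately have "m \<le> measure \<gamma> E" using m by linarith
    then have "\<eta> powr p * m \<le> \<eta> powr p * measure \<gamma> E"
      by (intro mult_left_mono) auto
    also have "\<dots> = (\<integral>z. \<eta> powr p * indicator E z \<partial>\<gamma>)" by simp
    also have "\<dots> \<le> (\<integral>z. dist (fst z) (snd z) powr p \<partial>\<gamma>)"
    proof (rule integral_mono[OF _ int])
      show "integrable \<gamma> (\<lambda>z. \<eta> powr p * indicator E z)" using E by (simp add: emeasure_eq_measure)
      show "\<eta> powr p * indicator E z \<le> dist (fst z) (snd z) powr p" for z
        using gap \<eta> p by (auto simp: E_def indicator_def intro!: powr_mono2)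
    qed
    finally show ?thesis .
  qed
  then have "\<eta> powr p * m \<le> (INF \<gamma>\<in>couplings \<mu> \<nu>. \<integral>z. dist (fst z) (snd z) powr p \<partial>\<gamma>)"
    using ne by (intro cINF_greatest)
  then have "(\<eta> powr p * m) powr (1 / p) \<le> wasserstein p \<mu> \<nu>"
    unfolding wasserstein_def using m p by (intro powr_mono2) auto
  then show ?thesis using \<eta> m p by (simp add: powr_mult powr_powr)
qed

text \<open>
  The product of two measures lives on the product of the Borel sigma-algebras, which may be smaller
  than the Borel sigma-algebra of the product. Images of a common discrete measure avoid this issue:
  moving the \<open>i\<close>-th atom to the \<open>i\<close>-th atom is a coupling.
\<close>

lemma couplings_distr_pmf:
  fixes q :: "'i pmf"
  shows "couplings (distr q borel f) (distr q borel g) \<noteq> {}"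
proof -
  have fst_m: "(fst :: 'a \<times> 'a \<Rightarrow> 'a) \<in> borel_measurable borel"
    by (intro borel_measurable_continuous_onI continuous_intros)
  have snd_m: "(snd :: 'a \<times> 'a \<Rightarrow> 'a) \<in> borel_measurable borel"
    by (intro borel_measurable_continuous_onI continuous_intros)
  have "distr q borel (\<lambda>i. (f i, g i)) \<in> couplings (distr q borel f) (distr q borel g)"
    by (auto simp: couplings_def borel_prob_measures_def distr_distr[OF fst_m] distr_distr[OF snd_m]
        comp_def intro!: measure_pmf.prob_space_distr)
  then show ?thesis by blast
qed

lemma push_forward_pow_distr:
  fixes \<phi> :: "'a::topological_space \<Rightarrow> 'a" and q :: "'i pmf"
  assumes "continuous_on UNIV \<phi>"
  shows "(push_forward \<phi> ^^ i) (distr q borel f) = distr q borel (\<lambda>l. (\<phi> ^^ i) (f l))"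
  using borel_measurable_continuous_onI[OF assms]
  by (induction i) (simp_all add: push_forward_def distr_distr comp_def)

section \<open>Separated sets of discrete measures\<close>

text \<open>Pigeonhole principle: \<open>N\<close> disjoint open intervals against fewer than \<open>N\<close> values.\<close>

lemma exists_empty_interval:
  fixes t :: "'i \<Rightarrow> real"
  assumes fin: "finite J" and card: "card J < N" and \<eta>: "0 < \<eta>"
  shows "\<exists>m<N. \<forall>l\<in>J. \<not> (real m * \<eta> < t l \<and> t l < (real m + 1) * \<eta>)"
proof (rule ccontr)
  assume "\<not> ?thesis"
  then have "\<forall>m\<in>{..<N}. \<exists>l\<in>J. real m * \<eta> < t l \<and> t l < (real m + 1) * \<eta>" by auto
  then obtain h where h: "\<And>m. m < N \<Longrightarrow> h m \<in> J"
      "\<And>m. m < N \<Longrightarrow> real m * \<eta> < t (h m) \<and> t (h m) < (real m + 1) * \<eta>"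
    by (metis lessThan_iff)
  have "inj_on h {..<N}"
  proof (rule inj_onI)
    fix a b assume ab: "a \<in> {..<N}" "b \<in> {..<N}" "h a = h b"
    have "real a * \<eta> < (real b + 1) * \<eta>" "real b * \<eta> < (real a + 1) * \<eta>"
      using h(2)[of a] h(2)[of b] ab by auto
    then show "a = b" using \<eta> by simp
  qed
  then have "card {..<N} \<le> card J" using h fin by (intro card_inj_on_le[of h]) auto
  then show False using card by simp
qed

text \<open>
  The two balls are chosen so that no atom common to both measures lies in the annulus between them.
  The common atoms then contribute the same mass on both sides, and the comparison is between
  the atom \<open>f j\<close> and the atoms of \<open>g\<close> below \<open>j\<close>; the atom \<open>g j\<close> is outside the larger ball.
\<close>

lemma binary_distr_mass_gap:
  fixes f g :: "nat \<Rightarrow> 'a::metric_space"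
  assumes j: "j < k" and agree: "\<And>l. j < l \<Longrightarrow> l < k \<Longrightarrow> f l = g l"
    and sep: "\<delta> \<le> dist (f j) (g j)" and \<delta>: "0 < \<delta>"
  obtains r where
    "1 / 2 ^ k \<le> measure (distr (binary_pmf k) borel f) (cball (f j) r)
        - measure (distr (binary_pmf k) borel g) (ball (f j) (r + \<delta> / k))"
proof -
  let ?q = "binary_pmf k"
  define \<eta> where "\<eta> = \<delta> / k"
  have \<eta>: "0 < \<eta>" using \<delta> j by (simp add: \<eta>_def)
  \<comment> \<open>There are at most \<open>k - 1\<close> common atoms, so one of \<open>k\<close> annuli of width \<open>\<eta>\<close> is free of them.\<close>
  obtain m where m: "m < k"
    and empty: "\<And>l. l \<in> {j<..<k} \<Longrightarrow>
      \<not> (real m * \<eta> < dist (f j) (g l) \<and> dist (f j) (g l) < (real m + 1) * \<eta>)"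
    using exists_empty_interval[of "{j<..<k}" k \<eta> "\<lambda>l. dist (f j) (g l)"] j \<eta> by auto
  define r where "r = real m * \<eta>"
  have r: "0 \<le> r" using \<eta> by (simp add: r_def)
  have "(real m + 1) * \<eta> \<le> real k * \<eta>" using m \<eta> by (intro mult_right_mono) auto
  then have far: "r + \<eta> \<le> \<delta>" using j by (simp add: r_def \<eta>_def add_divide_distrib distrib_right)
  define C where "C = {l \<in> {j<..<k}. f l \<in> cball (f j) r}"
  have "measure ?q (g -` ball (f j) (r + \<eta>)) = measure ?q (g -` ball (f j) (r + \<eta>) \<inter> set_pmf ?q)"
    by (simp add: measure_Int_set_pmf)
  also have "\<dots> \<le> measure ?q ({..<j} \<union> C)"
  proof (rule measure_pmf.finite_measure_mono)
    show "g -` ball (f j) (r + \<eta>) \<inter> set_pmf ?q \<subseteq> {..<j} \<union> C"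
    proof
      fix l assume l: "l \<in> g -` ball (f j) (r + \<eta>) \<inter> set_pmf ?q"
      then have lk: "l < k" and near: "dist (f j) (g l) < r + \<eta>"
        using set_binary_pmf[of k] j by auto
      have "l \<noteq> j" using near far sep by auto
      then consider "l < j" | "l \<in> {j<..<k}" using lk by force
      then show "l \<in> {..<j} \<union> C"
      proof cases
        case 2
        then show ?thesis
          using near empty[OF 2] agree[of l] by (auto simp: C_def r_def algebra_simps)
      qed simp
    qed
  qed simp
  also have "\<dots> = measure ?q {..<j} + measure ?q C"
    by (rule measure_pmf.finite_measure_Union) (auto simp: C_def)
  finally have upper: "measure ?q (g -` ball (f j) (r + \<eta>)) \<le> measure ?q {..<j} + measure ?q C" .
  have "measure ?q {j} + measure ?q C = measure ?q ({j} \<union> C)"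
    by (rule measure_pmf.finite_measure_Union[symmetric]) (auto simp: C_def)
  also have "\<dots> \<le> measure ?q (f -` cball (f j) r)"
    using r by (intro measure_pmf.finite_measure_mono) (auto simp: C_def)
  finally have lower: "measure ?q {j} + measure ?q C \<le> measure ?q (f -` cball (f j) r)" .
  have "1 / 2 ^ k \<le> 1 / (2 ^ k - 1 :: real)"
    using j by (intro divide_left_mono) (auto intro!: mult_pos_pos)
  then have "1 / 2 ^ k \<le> measure ?q (f -` cball (f j) r) - measure ?q (g -` ball (f j) (r + \<eta>))"
    using upper lower binary_pmf_dominates[OF j] by linarith
  then show thesis
    by (intro that[of r]) (simp add: measure_distr \<eta>_def)
qed

text \<open>
  Pushing forward a weighted sum of atoms moves the atoms and keeps the weights, so the mass gap
  applies at the time \<open>i\<close> that separates the decisive atoms. It bounds the distance from below,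
  and it also shows directly that different tuples yield different measures.
\<close>

lemma sep_count_wasserstein_ge:
  fixes \<phi> :: "'a::metric_space \<Rightarrow> 'a" and p :: real
  assumes p: "1 \<le> p" and comp: "compact (UNIV :: 'a set)" and cont: "continuous_on UNIV \<phi>"
    and fin: "finite S" and sep: "separated UNIV dist \<phi> n \<delta> S" and \<delta>: "0 < \<delta>"
    and k: "0 < k" and \<epsilon>: "\<epsilon> \<le> \<delta> / k * 2 powr (- real k / p)"
  shows "enat (card S ^ k) \<le> sep_count borel_prob_measures (wasserstein p) (push_forward \<phi>) \<epsilon> n"
proof -
  define M where "M f = distr (binary_pmf k) borel f" for f :: "nat \<Rightarrow> 'a"
  define F where "F = {..<k} \<rightarrow>\<^sub>E S"
  have finF: "finite F" and cardF: "card F = card S ^ k"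
    using fin by (auto simp: F_def finite_PiE card_PiE)
  have key: "\<exists>i\<le>n. M (\<lambda>l. (\<phi> ^^ i) (f l)) \<noteq> M (\<lambda>l. (\<phi> ^^ i) (g l)) \<and>
      \<epsilon> \<le> wasserstein p (M (\<lambda>l. (\<phi> ^^ i) (f l))) (M (\<lambda>l. (\<phi> ^^ i) (g l)))"
    if fg: "f \<in> F" "g \<in> F" "f \<noteq> g" for f g
  proof -
    define D where "D = {l. l < k \<and> f l \<noteq> g l}"
    have "D \<noteq> {}" using fg PiE_ext[of f "{..<k}" "\<lambda>_. S" g] by (auto simp: D_def F_def)
    moreover have "finite D" by (simp add: D_def)
    ultimately have "Max D \<in> D" and max: "\<And>l. l \<in> D \<Longrightarrow> l \<le> Max D" by auto
    define j where "j = Max D"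
    have j: "j < k" "f j \<noteq> g j" using \<open>Max D \<in> D\<close> by (auto simp: D_def j_def)
    have agree: "f l = g l" if "j < l" "l < k" for l
      using max[of l] that unfolding j_def by (fastforce simp: D_def)
    have "f j \<in> S" "g j \<in> S" using fg j by (auto simp: F_def)
    then have "\<delta> \<le> bowen_dist dist \<phi> n (f j) (g j)" using sep j by (auto simp: separated_def)
    then obtain i where i: "i \<le> n" and far: "\<delta> \<le> dist ((\<phi> ^^ i) (f j)) ((\<phi> ^^ i) (g j))"
      by (auto simp: bowen_dist_def Max_ge_iff)
    let ?f = "\<lambda>l. (\<phi> ^^ i) (f l)" and ?g = "\<lambda>l. (\<phi> ^^ i) (g l)"
    obtain r where r: "1 / 2 ^ k \<le> measure (M ?f) (cball (?f j) r)
        - measure (M ?g) (ball (?f j) (r + \<delta> / k))"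
      using binary_distr_mass_gap[of j k ?f ?g \<delta>] j agree far \<delta> by (auto simp: M_def)
    have "\<delta> / k * (1 / 2 ^ k) powr (1 / p) \<le> wasserstein p (M ?f) (M ?g)"
    proof (rule wasserstein_ge[OF _ comp _ _ _ _ _ _ r])
      show "couplings (M ?f) (M ?g) \<noteq> {}" unfolding M_def by (rule couplings_distr_pmf)
      show "\<delta> / k \<le> dist x y" if "x \<in> cball (?f j) r" "y \<notin> ball (?f j) (r + \<delta> / k)" for x y
        using that dist_triangle[of "?f j" y x] by auto
    qed (use p \<delta> in auto)
    moreover have "(1 / 2 ^ k) powr (1 / p) = 2 powr (- real k / p)"
      by (simp add: powr_minus_divide powr_divide powr_powr flip: powr_realpow)
    ultimately have W: "\<epsilon> \<le> wasserstein p (M ?f) (M ?g)" using \<epsilon> by simp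
    have "M ?f \<noteq> M ?g"
    proof
      assume eq: "M ?f = M ?g"
      have "cball (?f j) r \<subseteq> ball (?f j) (r + \<delta> / k)"
        unfolding subset_iff mem_cball mem_ball
        using divide_pos_pos[of \<delta> "real k"] \<delta> k by (metis of_nat_0_less_iff le_less_trans less_add_same_cancel1)
      then have "measure (M ?g) (cball (?f j) r) \<le> measure (M ?g) (ball (?f j) (r + \<delta> / k))"
        by (intro finite_measure.finite_measure_mono)
          (auto simp: M_def intro!: prob_space.finite_measure measure_pmf.prob_space_distr)
      moreover have "(0::real) < 1 / 2 ^ k" by simp
      ultimately show False using r[unfolded eq] by linarith
    qed
    then show ?thesis using i W by blast
  qed
  have pow: "(push_forward \<phi> ^^ i) (M f) = M (\<lambda>l. (\<phi> ^^ i) (f l))" for i f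
    unfolding M_def by (rule push_forward_pow_distr[OF cont])
  have "inj_on M F"
    by (rule inj_onI) (metis key pow)
  then have "card (M ` F) = card S ^ k" by (simp add: card_image cardF)
  moreover have "separated borel_prob_measures (wasserstein p) (push_forward \<phi>) n \<epsilon> (M ` F)"
    unfolding separated_def
  proof (intro conjI ballI impI)
    show "M ` F \<subseteq> borel_prob_measures"
      by (auto simp: borel_prob_measures_def M_def intro!: measure_pmf.prob_space_distr)
    fix \<mu> \<nu> assume "\<mu> \<in> M ` F" "\<nu> \<in> M ` F" "\<mu> \<noteq> \<nu>"
    then obtain f g where "f \<in> F" "g \<in> F" "f \<noteq> g" and eq: "\<mu> = M f" "\<nu> = M g" by blast
    from key[OF this(1-3)] obtain i where "i \<le> n"
      "\<epsilon> \<le> wasserstein p ((push_forward \<phi> ^^ i) \<mu>) ((push_forward \<phi> ^^ i) \<nu>)"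
      by (auto simp: eq pow)
    then show "\<epsilon> \<le> bowen_dist (wasserstein p) (push_forward \<phi>) n \<mu> \<nu>"
      by (auto simp: bowen_dist_def Max_ge_iff)
  qed
  ultimately show ?thesis
    unfolding sep_count_def using finF by (intro SUP_upper2[of "M ` F"]) auto
qed

section \<open>Growth of separated sets from positive entropy\<close>

lemma le_Limsup_frequently:
  fixes f :: "'b \<Rightarrow> 'c::complete_linorder"
  assumes "\<exists>\<^sub>F x in F. a \<le> f x"
  shows "a \<le> Limsup F f"
  unfolding Limsup_def
proof (rule INF_greatest)
  fix P assume "P \<in> {P. eventually P F}"
  then have "\<exists>\<^sub>F x in F. P x \<and> a \<le> f x"
    using frequently_eventually_conj[OF assms] by simp
  then obtain x where "P x" "a \<le> f x" by (auto dest: frequently_ex)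
  then show "a \<le> Sup (f ` Collect P)" by (intro SUP_upper2[of x]) auto
qed

text \<open>
  The growth rate of separated sets increases as the scale decreases, so the limit in the
  definition of the entropy exists.
\<close>

lemma tendsto_at_right_antimono:
  fixes H :: "real \<Rightarrow> ereal"
  assumes anti: "\<And>x y. 0 < x \<Longrightarrow> x \<le> y \<Longrightarrow> H y \<le> H x"
  shows "(H \<longlongrightarrow> (SUP x\<in>{0<..}. H x)) (at_right 0)"
proof (rule order_tendstoI)
  fix a assume "a < (SUP x\<in>{0<..}. H x)"
  then obtain x where x: "0 < x" "a < H x" by (auto simp: less_SUP_iff)
  have "\<forall>\<^sub>F y in at_right 0. y \<in> {0<..<x}" using x by (intro eventually_at_right_real) auto
  then show "\<forall>\<^sub>F y in at_right 0. a < H y"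
    by eventually_elim (use x anti in \<open>auto intro: less_le_trans\<close>)
next
  fix a assume a: "(SUP x\<in>{0<..}. H x) < a"
  have "\<forall>\<^sub>F y in at_right 0. y \<in> {0<..<1::real}" by (intro eventually_at_right_real) auto
  then show "\<forall>\<^sub>F y in at_right 0. H y < a"
    by eventually_elim (use a in \<open>auto intro!: le_less_trans[OF SUP_upper a]\<close>)
qed

lemma sep_count_antimono: "\<epsilon> \<le> \<epsilon>' \<Longrightarrow> sep_count X d f \<epsilon>' n \<le> sep_count X d f \<epsilon> n"
  unfolding sep_count_def separated_def by (intro SUP_subset_mono) fastforce+

lemma ln_enat_mono: "a \<le> b \<Longrightarrow> ln_enat a \<le> ln_enat b"
proof (cases a; cases b)
  fix m n assume "a \<le> b" "a = enat m" "b = enat n"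
  then show ?thesis by (cases "m = 0"; cases "n = 0") (auto simp: ln_enat_def)
qed (auto simp: ln_enat_def)

lemma topological_entropy_eq_SUP:
  "topological_entropy X d f =
     (SUP \<epsilon>\<in>{0<..}. limsup (\<lambda>n. ln_enat (sep_count X d f \<epsilon> n) / ereal (real n)))"
  unfolding topological_entropy_def
proof (rule tendsto_Lim[OF _ tendsto_at_right_antimono])
  fix x y :: real assume "0 < x" "x \<le> y"
  show "limsup (\<lambda>n. ln_enat (sep_count X d f y n) / ereal (real n))
      \<le> limsup (\<lambda>n. ln_enat (sep_count X d f x n) / ereal (real n))"
    using \<open>x \<le> y\<close> by (intro Limsup_mono eventually_sequentiallyI[of 1] ereal_divide_right_mono
        ln_enat_mono sep_count_antimono) auto
qed simp

lemma exists_separated_of_entropy: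
  assumes c: "0 \<le> c" "ereal c < topological_entropy X d f"
  obtains \<delta> where "0 < \<delta>"
    "\<exists>\<^sub>F n in sequentially. 0 < n \<and> (\<exists>S. finite S \<and> separated X d f n \<delta> S \<and> exp (c * n) < card S)"
proof -
  obtain \<delta> where \<delta>: "0 < \<delta>"
    and lim: "ereal c < limsup (\<lambda>n. ln_enat (sep_count X d f \<delta> n) / ereal (real n))"
    using c by (auto simp: topological_entropy_eq_SUP less_SUP_iff)
  have "\<exists>\<^sub>F n in sequentially. ereal c < ln_enat (sep_count X d f \<delta> n) / ereal (real n)"
    using lim Limsup_bounded[of "\<lambda>n. ln_enat (sep_count X d f \<delta> n) / ereal (real n)" "ereal c" sequentially]
    by (auto simp: frequently_def not_less)
  then have "\<exists>\<^sub>F n in sequentially. 0 < n \<and> ereal c < ln_enat (sep_count X d f \<delta> n) / ereal (real n)"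
    by (rule frequently_eventually_conj[OF _ eventually_gt_at_top])
  then have "\<exists>\<^sub>F n in sequentially. 0 < n \<and> (\<exists>S. finite S \<and> separated X d f n \<delta> S \<and> exp (c * n) < card S)"
  proof (rule frequently_mono[rotated], intro allI impI)
    fix n assume n: "0 < n \<and> ereal c < ln_enat (sep_count X d f \<delta> n) / ereal (real n)"
    \<comment> \<open>Comparing with a finite number also covers the case of an infinite count.\<close>
    let ?N = "nat \<lfloor>exp (c * n)\<rfloor>"
    have "ereal (c * n) < ln_enat (sep_count X d f \<delta> n)"
      using n ereal_less_divide_pos[of "ereal (real n)" "ereal c"] by (simp add: mult.commute)
    then have "enat ?N < sep_count X d f \<delta> n"
    proof (cases "sep_count X d f \<delta> n")
      case (enat m)
      with \<open>ereal (c * n) < _\<close> have m: "c * n < ln m" by (simp add: ln_enat_def)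
      moreover have "0 \<le> c * n" using c by simp
      \<comment> \<open>Here \<open>0 \<le> c\<close> enters: \<open>ln 0 = 0\<close>, so an empty count would pass for a negative \<open>c\<close>.\<close>
      ultimately have "m \<noteq> 0" by (intro notI) simp
      then have "exp (c * n) < m" using m by (metis exp_less_mono exp_ln of_nat_0_less_iff not_gr_zero)
      then show ?thesis using enat by (simp add: nat_less_iff floor_less_iff)
    qed simp
    then obtain S where "finite S" "separated X d f n \<delta> S" "?N < card S"
      by (auto simp: sep_count_def less_SUP_iff)
    moreover from this have "exp (c * n) < card S" by linarith
    ultimately show "0 < n \<and> (\<exists>S. finite S \<and> separated X d f n \<delta> S \<and> exp (c * n) < card S)"
      using n by blast
  qed
  then show thesis using \<delta> that by blast
qed

section \<open>Choice of the number of atoms\<close>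

text \<open>
  With \<open>L = \<bar>ln \<epsilon>\<bar>\<close> the last inequality reads \<open>ln k + k * ln 2 / p - ln \<delta> \<le> L\<close>. For
  \<open>k = \<lceil>a * L\<rceil>\<close> its left side is \<open>(a * ln 2 / p) * L\<close> up to \<open>O(ln L)\<close>, with a coefficient less
  than 1 exactly when \<open>a < p / ln 2\<close>.
\<close>

lemma eventually_exists_scale:
  fixes \<delta> p a :: real
  assumes \<delta>: "0 < \<delta>" and p: "0 < p" and a: "0 < a" "a < p / ln 2"
  shows "\<forall>\<^sub>F \<epsilon> in at_right 0. 0 < \<bar>ln \<epsilon>\<bar> \<and>
    (\<exists>k::nat. 0 < k \<and> a * \<bar>ln \<epsilon>\<bar> \<le> k \<and> \<epsilon> \<le> \<delta> / k * 2 powr (- real k / p))"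
proof -
  define b where "b = a * ln 2 / p"
  have b: "b < 1" using a p by (simp add: b_def field_simps)
  have "\<forall>\<^sub>F L in at_top. ln (a * L + 1) + b * L + (ln 2 / p - ln \<delta>) \<le> L"
    using a b by real_asymp
  moreover have "filterlim (\<lambda>\<epsilon>::real. - ln \<epsilon>) at_top (at_right 0)" by real_asymp
  ultimately have "\<forall>\<^sub>F \<epsilon> in at_right 0.
      ln (a * (- ln \<epsilon>) + 1) + b * (- ln \<epsilon>) + (ln 2 / p - ln \<delta>) \<le> - ln \<epsilon>"
    by (rule eventually_compose_filterlim)
  moreover have "\<forall>\<^sub>F \<epsilon> in at_right 0. \<epsilon> \<in> {0<..<1::real}" by (intro eventually_at_right_real) auto
  ultimately show ?thesis
  proof eventually_elim
    case (elim \<epsilon>)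
    define L where "L = - ln \<epsilon>"
    have L: "0 < L" "\<bar>ln \<epsilon>\<bar> = L" using elim by (auto simp: L_def)
    define k where "k = nat \<lceil>a * L\<rceil>"
    have aL: "0 < a * L" using a L by simp
    then have k: "0 < k" "a * L \<le> k" "k \<le> a * L + 1" unfolding k_def by linarith+
    have "ln k + k * ln 2 / p - ln \<delta> \<le> ln (a * L + 1) + (a * L + 1) * ln 2 / p - ln \<delta>"
      using k p by (intro diff_right_mono add_mono divide_right_mono mult_right_mono) auto
    also have "\<dots> = ln (a * L + 1) + b * L + (ln 2 / p - ln \<delta>)"
      by (simp add: b_def algebra_simps add_divide_distrib)
    also have "\<dots> \<le> L" using elim by (simp add: L_def)
    finally have "ln \<epsilon> \<le> ln (\<delta> / k * 2 powr (- real k / p))"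
      using k \<delta> by (simp add: L_def ln_mult ln_div ln_powr)
    then have "\<epsilon> \<le> \<delta> / k * 2 powr (- real k / p)"
      using elim k \<delta> by (subst (asm) ln_le_cancel_iff) auto
    then show ?case using k L by auto
  qed
qed

lemma metric_mean_dimension_ge_mult:
  fixes \<phi> :: "'a::metric_space \<Rightarrow> 'a" and p :: real
  assumes p: "1 \<le> p" and comp: "compact (UNIV :: 'a set)" and cont: "continuous_on UNIV \<phi>"
    and a: "0 < a" "a < p / ln 2" and c: "0 \<le> c" "ereal c < topological_entropy UNIV dist \<phi>"
  shows "ereal (a * c) \<le>
    metric_mean_dimension borel_prob_measures (wasserstein p) (push_forward \<phi>)"
proof -
  obtain \<delta> where \<delta>: "0 < \<delta>" and freq: "\<exists>\<^sub>F n in sequentially. 0 < n \<and>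
      (\<exists>S. finite S \<and> separated UNIV dist \<phi> n \<delta> S \<and> exp (c * n) < card S)"
    using exists_separated_of_entropy[OF c] by blast
  show ?thesis
    unfolding metric_mean_dimension_def
  proof (rule Liminf_bounded)
    have "0 < p" using p by simp
    from eventually_exists_scale[OF \<delta> this a]
    show "\<forall>\<^sub>F \<epsilon> in at_right 0. ereal (a * c) \<le> limsup (\<lambda>n. ln_enat (sep_count borel_prob_measures
        (wasserstein p) (push_forward \<phi>) \<epsilon> n) / ereal (real n * \<bar>ln \<epsilon>\<bar>))"
    proof eventually_elim
      case (elim \<epsilon>)
      let ?s = "sep_count borel_prob_measures (wasserstein p) (push_forward \<phi>) \<epsilon>"
      obtain k :: nat where k: "0 < k" "a * \<bar>ln \<epsilon>\<bar> \<le> k" "\<epsilon> \<le> \<delta> / k * 2 powr (- real k / p)"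
        using elim by auto
      have "\<exists>\<^sub>F n in sequentially. ereal (a * c) \<le> ln_enat (?s n) / ereal (real n * \<bar>ln \<epsilon>\<bar>)"
      proof (rule frequently_mono[OF _ freq], intro allI impI, elim conjE exE)
        fix n S assume n: "0 < n" and S: "finite S" "separated UNIV dist \<phi> n \<delta> S"
          and card: "exp (c * n) < card S"
        have "c * n \<le> ln (card S)"
          using card less_trans[OF exp_gt_zero card] by (subst ln_ge_iff) auto
        then have "a * \<bar>ln \<epsilon>\<bar> * (c * n) \<le> k * ln (card S)"
          using k a c by (intro mult_mono) auto
        also have "\<dots> = ln (card S ^ k)"
          using less_trans[OF exp_gt_zero card] by (simp add: ln_realpow)
        finally have "ereal (a * c * (real n * \<bar>ln \<epsilon>\<bar>)) \<le> ln_enat (enat (card S ^ k))"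
          by (simp add: ln_enat_def mult_ac)
        also have "\<dots> \<le> ln_enat (?s n)"
          by (intro ln_enat_mono sep_count_wasserstein_ge[OF p comp cont S \<delta> k(1,3)])
        finally show "ereal (a * c) \<le> ln_enat (?s n) / ereal (real n * \<bar>ln \<epsilon>\<bar>)"
          using n elim by (subst ereal_le_divide_pos) (auto simp: mult_ac)
      qed
      then show ?case
        by (rule le_Limsup_frequently)
    qed
  qed
qed

lemma ereal_mult_le_of_factors_below:
  fixes M v :: ereal and u :: real
  assumes u: "0 < u" and v: "0 < v"
    and le: "\<And>a c. 0 < a \<Longrightarrow> a < u \<Longrightarrow> 0 < c \<Longrightarrow> ereal c < v \<Longrightarrow> ereal (a * c) \<le> M"
  shows "ereal u * v \<le> M"
proof -
  have below: "ereal u * ereal c \<le> M" if c: "0 < c" "ereal c < v" for c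
  proof -
    have "ereal u \<le> M / ereal c"
    proof (rule dense_le_bounded[of 0])
      fix w assume w: "0 < w" "w < ereal u"
      then obtain a where "w = ereal a" by (cases w) auto
      then show "w \<le> M / ereal c"
        using w c le[of a c] by (simp add: ereal_le_divide_pos mult.commute)
    qed (use u in simp)
    then show ?thesis using c by (simp add: ereal_le_divide_pos mult.commute)
  qed
  have "v \<le> M / ereal u"
  proof (rule dense_le_bounded[OF v])
    fix w assume w: "0 < w" "w < v"
    then obtain c where "w = ereal c" by (cases w) auto
    then show "w \<le> M / ereal u"
      using w u below[of c] by (simp add: ereal_le_divide_pos)
  qed
  then show ?thesis using u by (simp add: ereal_le_divide_pos)
qed

text \<open>
  The product \<open>a * c\<close> is a lower bound for every \<open>a\<close> below \<open>p / ln 2\<close> and every \<open>c\<close> below the entropy;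
  the bound passes to the suprema, also when the entropy is infinite.
\<close>

theorem corollary1p3:
  fixes \<phi> :: "'a::metric_space \<Rightarrow> 'a" and p :: real
  assumes "1 \<le> p"
    and "compact (UNIV :: 'a set)"
    and "continuous_on UNIV \<phi>"
    and "topological_entropy UNIV dist \<phi> > 0"
  shows "metric_mean_dimension borel_prob_measures (wasserstein p) (push_forward \<phi>) > 0
    \<and> metric_mean_dimension borel_prob_measures (wasserstein p) (push_forward \<phi>)
        \<ge> ereal p * (topological_entropy UNIV dist \<phi> / ereal (ln 2))"
proof -
  let ?h = "topological_entropy UNIV dist \<phi>"
  let ?M = "metric_mean_dimension borel_prob_measures (wasserstein p) (push_forward \<phi>)"
  have u: "0 < p / ln 2" using assms(1) by simp
  have "ereal (p / ln 2) * ?h \<le> ?M"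
  proof (rule ereal_mult_le_of_factors_below[OF u assms(4)])
    fix a c :: real assume "0 < a" "a < p / ln 2" "0 < c" "ereal c < ?h"
    then show "ereal (a * c) \<le> ?M"
      by (intro metric_mean_dimension_ge_mult[OF assms(1-3)]) auto
  qed
  moreover have "ereal (p / ln 2) * ?h = ereal p * (?h / ereal (ln 2))"
    by (cases ?h) (use assms(1) in auto)
  moreover have "0 < ereal (p / ln 2) * ?h"
    using u assms(4) by (simp add: ereal_zero_less_0_iff)
  ultimately show ?thesis by auto
qed

end
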